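(* The category of finite sets with relations, $\mathrm{Rel}$, is dimension zero over $F$ for every infinite field $F$; that is, every finitely generated representation of $\mathrm{Rel}$ over $F$ has finite length.
   Context: The category $\mathrm{Rel}$ of finite sets with relations is defined as follows. Let $R=\{0,1\}$ with addition $+$ given by logical OR and multiplication $*$ given by logical AND. The objects of $\mathrm{Rel}$ are the whole numbers (nonnegative integers; the number $n$ stands for the finite set $\{1,\dots,n\}$). For whole numbers $x,y$, a morphism from $x$ to $y$ is an $x\times y$ matrix with entries in $R$ (i.e. a relation between $\{1,\dots,x\}$ and $\{1,\dots,y\}$). Composition is matrix multiplication over $R$: for $A=(a_{i,j})\in\mathrm{Hom}(x,y)$ and $B=(b_{i,j})\in\mathrm{Hom}(y,z)$, $B\circ A = AB = \left(\sum_{k=1}^{y} a_{i,k}*b_{k,j}\right)\in\mathrm{Hom}(x,z)$. The identity morphism of $x$ is the $x\times x$ identity matrix. Let $\mathscr{D}$ be a category and $F$ a field. A representation of $\mathscr{D}$ over $F$ is a functor $V$ from $\mathscr{D}$ to the category $\mathrm{Vect}_F$ of $F$-vector spaces (of arbitrary dimension) and linear maps. A subrepresentation of $V$ is a representation $W$ such that $W(d)$ is a vector subspace of $V(d)$ for every object $d$ and $W(f)$ is the restriction of $V(f)$ to $W(d)$ for every morphism $f:d\to d'$. A representation $V$ is finitely generated if there exist finitely many objects $d_1,\dots,d_i$ and, for each $k$, finitely many vectors $v_{k,1},\dots,v_{k,j_k}\in V(d_k)$ such that any subrepresentation $W$ of $V$ with $v_{k,l}\in W(d_k)$ for all $k,l$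 equals $V$. A representation $V$ is finite length if every non-repetitive chain of subrepresentations of $V$ is finite (equivalently, $V$ has a finite composition series $0=W_0\subsetneq\cdots\subsetneq W_n=V$ with each $W_{i+1}/W_i$ irreducible, i.e. nonzero with no subrepresentations other than zero and itself). The category $\mathscr{D}$ is dimension zero over $F$ if every finitely generated representation of $\mathscr{D}$ over $F$ is finite length. *)

theory Defs
  imports
    "Jordan_Normal_Form.Matrix"
    "Jordan_Normal_Form.Missing_VectorSpace"
begin

text \<open>The objects of a category are all elements of the type \<open>'o\<close>. Composition takes no object
  arguments, so the hom-sets are required to be pairwise disjoint. \<open>Comp C g f\<close> is \<open>g\<close> after \<open>f\<close>.\<close>

record ('o, 'm) cat =
  Hom :: "'o \<Rightarrow> 'o \<Rightarrow> 'm set"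
  Id :: "'o \<Rightarrow> 'm"
  Comp :: "'m \<Rightarrow> 'm \<Rightarrow> 'm"

locale is_category =
  fixes C :: "('o, 'm) cat"
  assumes Hom_disjoint: "f \<in> Hom C x y \<Longrightarrow> f \<in> Hom C x' y' \<Longrightarrow> x = x' \<and> y = y'"
    and Id_in_Hom: "Id C x \<in> Hom C x x"
    and Comp_in_Hom: "f \<in> Hom C x y \<Longrightarrow> g \<in> Hom C y z \<Longrightarrow> Comp C g f \<in> Hom C x z"
    and Comp_assoc: "f \<in> Hom C w x \<Longrightarrow> g \<in> Hom C x y \<Longrightarrow> h \<in> Hom C y z \<Longrightarrow>
          Comp C h (Comp C g f) = Comp C (Comp C h g) f"
    and Comp_Id_right: "f \<in> Hom C x y \<Longrightarrow> Comp C f (Id C x) = f"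
    and Comp_Id_left: "f \<in> Hom C x y \<Longrightarrow> Comp C (Id C y) f = f"


text \<open>The semiring \<open>{0, 1}\<close> with OR as addition and AND as multiplication.\<close>

instantiation bool :: comm_semiring_1
begin

definition zero_bool_def: "(0 :: bool) \<longleftrightarrow> False"
definition one_bool_def: "(1 :: bool) \<longleftrightarrow> True"
definition plus_bool_def: "(a :: bool) + b \<longleftrightarrow> a \<or> b"
definition times_bool_def: "(a :: bool) * b \<longleftrightarrow> a \<and> b"

instance
  by standard (auto simp: zero_bool_def one_bool_def plus_bool_def times_bool_def)

end

definition Rel :: "(nat, bool mat) cat" where
  "Rel = \<lparr>Hom = (\<lambda>x y. carrier_mat x y), Id = (\<lambda>x. 1\<^sub>m x), Comp = (\<lambda>B A. A * B)\<rparr>"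

lemma is_category_Rel: "is_category Rel"
proof
  fix f g h :: "bool mat" and w x y z :: nat
  assume "f \<in> Hom Rel w x" "g \<in> Hom Rel x y" "h \<in> Hom Rel y z"
  then show "Comp Rel h (Comp Rel g f) = Comp Rel (Comp Rel h g) f"
    by (simp add: Rel_def)
qed (auto simp: Rel_def)


text \<open>A functor to vector spaces over \<open>F\<close>, with object part \<open>V\<close> and morphism part \<open>T\<close>. The values
  of \<open>T f\<close> outside the carrier of the source space are irrelevant.\<close>

locale representation =
  fixes C :: "('o, 'm) cat" and F :: "('a, 'b) ring_scheme"
    and V :: "'o \<Rightarrow> ('a, 'v) module" and T :: "'m \<Rightarrow> 'v \<Rightarrow> 'v"
  assumes vectorspace: "vectorspace F (V x)"
    and linear: "f \<in> Hom C x y \<Longrightarrow> linear_map F (V x) (V y) (T f)"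
    and map_Id: "v \<in> carrier (V x) \<Longrightarrow> T (Id C x) v = v"
    and map_Comp: "f \<in> Hom C x y \<Longrightarrow> g \<in> Hom C y z \<Longrightarrow> v \<in> carrier (V x) \<Longrightarrow>
          T (Comp C g f) v = T g (T f v)"

text \<open>A subrepresentation is given by its family \<open>W\<close> of carriers; its operations and its morphism
  part are those of \<open>V\<close> and \<open>T\<close>.\<close>

definition subrepresentation ::
  "('o, 'm) cat \<Rightarrow> ('a, 'b) ring_scheme \<Rightarrow> ('o \<Rightarrow> ('a, 'v) module) \<Rightarrow> ('m \<Rightarrow> 'v \<Rightarrow> 'v) \<Rightarrow>
    ('o \<Rightarrow> 'v set) \<Rightarrow> bool" where
  "subrepresentation C F V T W \<longleftrightarrow>
     (\<forall>d. VectorSpace.subspace F (W d) (V d)) \<and>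
     representation C F (\<lambda>d. (V d)\<lparr>carrier := W d\<rparr>) T"

lemma (in representation) subrepresentation_iff:
  "subrepresentation C F V T W \<longleftrightarrow>
     (\<forall>d. VectorSpace.subspace F (W d) (V d)) \<and>
     (\<forall>x y f. f \<in> Hom C x y \<longrightarrow> T f ` W x \<subseteq> W y)" (is "?L \<longleftrightarrow> ?R")
proof
  assume L: ?L
  then interpret W: representation C F "\<lambda>d. (V d)\<lparr>carrier := W d\<rparr>" T
    by (simp add: subrepresentation_def)
  have "T f ` W x \<subseteq> W y" if f: "f \<in> Hom C x y" for f x y
  proof -
    interpret l: linear_map F "(V x)\<lparr>carrier := W x\<rparr>" "(V y)\<lparr>carrier := W y\<rparr>" "T f"
      by (rule W.linear[OF f])
    show ?thesis using l.T_im by auto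
  qed
  with L show ?R by (simp add: subrepresentation_def)
next
  assume R: ?R
  then have sub: "W x \<subseteq> carrier (V x)" for x
    by (meson submodule.subset VectorSpace.subspace.submod)
  have vs: "vectorspace F ((V x)\<lparr>carrier := W x\<rparr>)" for x
    using R vectorspace.subspace_is_vs[OF vectorspace] by blast
  have "representation C F (\<lambda>d. (V d)\<lparr>carrier := W d\<rparr>) T"
  proof (rule representation.intro)
    fix f x y assume f: "f \<in> Hom C x y"
    interpret l: linear_map F "V x" "V y" "T f" by (rule linear[OF f])
    have im: "T f v \<in> W y" if "v \<in> W x" for v using R f that by blast
    have "T f \<in> module_hom F ((V x)\<lparr>carrier := W x\<rparr>) ((V y)\<lparr>carrier := W y\<rparr>)"
      using sub[of x] im by (auto simp: module_hom_def subset_iff)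
    then show "linear_map F ((V x)\<lparr>carrier := W x\<rparr>) ((V y)\<lparr>carrier := W y\<rparr>) (T f)"
      using vs by (simp add: linear_map_def mod_hom_def mod_hom_axioms_def vectorspace_def)
  next
    fix v x assume "v \<in> carrier ((V x)\<lparr>carrier := W x\<rparr>)"
    then show "T (Id C x) v = v" using map_Id sub[of x] by auto
  next
    fix f x y g z v
    assume "f \<in> Hom C x y" "g \<in> Hom C y z" "v \<in> carrier ((V x)\<lparr>carrier := W x\<rparr>)"
    then show "T (Comp C g f) v = T g (T f v)" using map_Comp[of f x y g z v] sub[of x] by auto
  qed (rule vs)
  with R show ?L by (simp add: subrepresentation_def)
qed

definition finitely_generated ::
  "('o, 'm) cat \<Rightarrow> ('a, 'b) ring_scheme \<Rightarrow> ('o \<Rightarrow> ('a, 'v) module) \<Rightarrow> ('m \<Rightarrow> 'v \<Rightarrow> 'v) \<Rightarrow> bool" where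
  "finitely_generated C F V T \<longleftrightarrow>
     (\<exists>S \<subseteq> (SIGMA d:UNIV. carrier (V d)). finite S \<and>
        (\<forall>W. subrepresentation C F V T W \<and> (\<forall>(d, v) \<in> S. v \<in> W d) \<longrightarrow>
           W = (\<lambda>d. carrier (V d))))"

text \<open>The order on families of carriers is pointwise inclusion. As a chain is a set of
  subrepresentations, it has no repetitions.\<close>

definition finite_length ::
  "('o, 'm) cat \<Rightarrow> ('a, 'b) ring_scheme \<Rightarrow> ('o \<Rightarrow> ('a, 'v) module) \<Rightarrow> ('m \<Rightarrow> 'v \<Rightarrow> 'v) \<Rightarrow> bool" where
  "finite_length C F V T \<longleftrightarrow>
     (\<forall>K \<subseteq> {W. subrepresentation C F V T W}. Complete_Partial_Order.chain (\<le>) K \<longrightarrow> finite K)"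

text \<open>A definition cannot quantify over types, so the type \<open>'v\<close> of vectors is a parameter. A theorem
  about \<open>dimension_zero TYPE('v)\<close> for a type variable \<open>'v\<close> covers vector spaces of every dimension.\<close>

definition dimension_zero ::
  "'v itself \<Rightarrow> ('o, 'm) cat \<Rightarrow> ('a, 'b) ring_scheme \<Rightarrow> bool" where
  "dimension_zero _ C F \<longleftrightarrow>
     (\<forall>(V :: 'o \<Rightarrow> ('a, 'v) module) T.
        representation C F V T \<longrightarrow> finitely_generated C F V T \<longrightarrow> finite_length C F V T)"

end

theory Submission
  imports Defs
begin

text \<open>Let \<open>V\<close> be generated by vectors \<open>v\<close> in degrees \<open>d\<close>, so that \<open>V x\<close> is spanned by the vectors
  \<open>A v\<close> with \<open>A\<close> a boolean \<open>d \<times> x\<close> matrix. Fix \<open>N \<ge> 2 ^ d\<close> for all these \<open>d\<close>. The heart of the proof is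
  that a subrepresentation \<open>W\<close> is determined, inside any chain, by the single space \<open>W N\<close>
  (\<open>subrepresentations_eq_of_eq_at\<close>). As \<open>V N\<close> is finite-dimensional, its chains of subspaces are
  finite, and hence so are the chains of subrepresentations of \<open>V\<close>.

  To see this, let \<open>U \<le> W\<close> agree at \<open>N\<close>. For a map \<open>h\<close> from the \<open>x\<close> points to \<open>N\<close> points, let \<open>r\<^sub>h\<close> be
  the equivalence relation \<open>h a = h b\<close>. It is the composite of \<open>h\<close> with its converse and so factors
  through \<open>N\<close>; therefore it maps \<open>W x\<close> into \<open>U x\<close>, and modulo \<open>U x\<close> every \<open>w \<in> W x\<close> is equal to
  \<open>(1 - r\<^sub>h) w\<close>. It remains to find operators \<open>1 - r\<^sub>h\<close> whose product annihilates \<open>V x\<close>. Two facts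
  provide them:

  \<^item> A matrix \<open>A\<close> with \<open>d\<close> rows has at most \<open>2 ^ d \<le> N\<close> distinct columns, so some \<open>h\<close> tells exactly
    the distinct columns apart. Then \<open>A r\<^sub>h = A\<close>, and \<open>1 - r\<^sub>h\<close> kills \<open>A v\<close>
    (\<open>exists_fixing_collapse\<close>).
  \<^item> As \<open>r\<^sub>h\<close> is reflexive, passing from \<open>A\<close> to \<open>A r\<^sub>h\<close> never loses an entry, so \<open>1 - r\<^sub>h\<close> acts
    triangularly with respect to inclusion of relations (\<open>support_collapse\<close>).

  Hence the matrices needed to write \<open>w\<close> modulo \<open>U x\<close> can be eliminated one by one, a minimal one
  first, until none is left (\<open>span_collapse_closed_mem\<close>).\<close>


section \<open>Linear algebra\<close>

lemma hom_image_span_subset: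
  assumes M: "module R M" and f: "f \<in> module_hom R M N"
    and P: "submodule R P N" and S: "S \<subseteq> carrier M" "f ` S \<subseteq> P"
  shows "f ` module.span R M S \<subseteq> P"
proof -
  interpret M: module R M by (rule M)
  interpret P: submodule R P N by (rule P)
  interpret N: module R N by (rule P.module)
  interpret f: mod_hom R M N f
    by unfold_locales (rule f)
  have "submodule R {v \<in> carrier M. f v \<in> P} M"
    by (rule submodule.intro) (auto simp: M)
  then have "M.span S \<subseteq> {v \<in> carrier M. f v \<in> P}"
    using S by (intro M.span_is_subset) auto
  then show ?thesis by blast
qed

lemma submodule_minus_closed:
  assumes P: "submodule R P M" and "a \<in> P" "b \<in> P"
  shows "a \<ominus>\<^bsub>M\<^esub> b \<in> P"
proof -
  interpret P: submodule R P M by (rule P)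
  interpret M: module R M by (rule P.module)
  have "b \<in> carrier M" using assms P.subset by blast
  then have "\<ominus>\<^bsub>M\<^esub> b \<in> P"
    using assms(3) by (simp flip: M.smult_minus_1)
  then show ?thesis
    using assms(2) by (simp add: a_minus_def)
qed

lemma id_minus_hom:
  assumes M: "module R M" and f: "f \<in> module_hom R M M"
  shows "(\<lambda>v. v \<ominus>\<^bsub>M\<^esub> f v) \<in> module_hom R M M"
proof -
  interpret M: module R M by (rule M)
  have im: "f v \<in> carrier M" if "v \<in> carrier M" for v
    using module_hom_closed[OF f] that by auto
  have "v \<oplus>\<^bsub>M\<^esub> w \<ominus>\<^bsub>M\<^esub> f (v \<oplus>\<^bsub>M\<^esub> w) = (v \<ominus>\<^bsub>M\<^esub> f v) \<oplus>\<^bsub>M\<^esub> (w \<ominus>\<^bsub>M\<^esub> f w)"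
    if "v \<in> carrier M" "w \<in> carrier M" for v w
    using that im by (simp add: module_hom_add[OF f] a_minus_def M.minus_add M.a_ac)
  moreover have "c \<odot>\<^bsub>M\<^esub> v \<ominus>\<^bsub>M\<^esub> f (c \<odot>\<^bsub>M\<^esub> v) = c \<odot>\<^bsub>M\<^esub> (v \<ominus>\<^bsub>M\<^esub> f v)"
    if "c \<in> carrier R" "v \<in> carrier M" for c v
    using that im by (simp add: module_hom_smult[OF f] a_minus_def M.smult_r_distr M.smult_r_minus)
  ultimately show ?thesis
    using im by (auto simp: module_hom_def)
qed

text \<open>The largest size of an independent subset grows strictly along a chain of subspaces, since a
  vector outside a subspace can be added to any independent subset of it.\<close>

lemma (in vectorspace) finite_chain_of_subspaces:
  assumes fd: fin_dim and sub: "\<And>W. W \<in> \<C> \<Longrightarrow> subspace K W V"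
    and chain: "Complete_Partial_Order.chain (\<subseteq>) \<C>"
  shows "finite \<C>"
proof -
  define ranks where "ranks W = card ` {A. A \<subseteq> W \<and> lin_indpt A}" for W
  have carr: "W \<subseteq> carrier V" if "W \<in> \<C>" for W
    using sub[OF that] by (meson is_module submodule.subset)
  have ranks: "ranks W \<subseteq> {..dim}" if "W \<in> \<C>" for W
    using li_le_dim(2)[OF fd] carr[OF that] by (fastforce simp: ranks_def)
  then have fin: "finite (ranks W)" if "W \<in> \<C>" for W
    using that by (meson finite_atMost finite_subset)
  have ne: "ranks W \<noteq> {}" for W
    using finite_lin_indpt2[of "{}"] by (auto simp: ranks_def)
  have less: "Max (ranks U) < Max (ranks W)"
    if U: "U \<in> \<C>" and W: "W \<in> \<C>" and "U \<subset> W" for U W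
  proof -
    obtain A where A: "A \<subseteq> U" "lin_indpt A" "card A = Max (ranks U)"
      using Max_in[OF fin[OF U] ne] by (auto simp: ranks_def)
    obtain w where w: "w \<in> W" "w \<notin> U"
      using \<open>U \<subset> W\<close> by blast
    have "span A \<subseteq> U"
      using A(1) sub[OF U] by (intro span_is_subset) auto
    then have "w \<notin> span A" using w by blast
    moreover have "w \<notin> A" using A w by blast
    ultimately have "lin_indpt (A \<union> {w})"
      using lin_dep_iff_in_span[of A w] A w carr[OF U] carr[OF W] by blast
    then have "card (A \<union> {w}) \<in> ranks W"
      using A w \<open>U \<subset> W\<close> by (auto simp: ranks_def)
    moreover have "card (A \<union> {w}) = Suc (card A)"
      using fin_dim_li_fin[OF fd A(2)] A(1) carr[OF U] \<open>w \<notin> A\<close> by simp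
    ultimately show ?thesis
      using Max_ge[OF fin[OF W]] A(3) by fastforce
  qed
  have "inj_on (\<lambda>W. Max (ranks W)) \<C>"
  proof (rule inj_onI)
    fix U W assume "U \<in> \<C>" "W \<in> \<C>" and eq: "Max (ranks U) = Max (ranks W)"
    then have "U \<subseteq> W \<or> W \<subseteq> U" using chain by (auto simp: Complete_Partial_Order.chain_def)
    then show "U = W"
      using less[of U W] less[of W U] \<open>U \<in> \<C>\<close> \<open>W \<in> \<C>\<close> eq by fastforce
  qed
  moreover have "(\<lambda>W. Max (ranks W)) ` \<C> \<subseteq> {..dim}"
    using Max_in[OF fin ne] ranks by blast
  ultimately show ?thesis
    by (meson finite_atMost finite_subset inj_on_finite)
qed


section \<open>Finitely generated representations\<close>

definition (in representation) orbit :: "('o \<times> 'v) set \<Rightarrow> 'o \<Rightarrow> 'v set" where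
  "orbit S x = {T f v | d v f. (d, v) \<in> S \<and> f \<in> Hom C d x}"

context representation
begin

lemma T_closed: "f \<in> Hom C x y \<Longrightarrow> v \<in> carrier (V x) \<Longrightarrow> T f v \<in> carrier (V y)"
  using linear[of f x y] module_hom_closed[of "T f" F "V x" "V y"]
  by (auto simp: linear_map_def mod_hom_def mod_hom_axioms_def)

lemma orbit_carrier:
  assumes "S \<subseteq> (SIGMA d:UNIV. carrier (V d))"
  shows "orbit S x \<subseteq> carrier (V x)"
  using assms T_closed by (fastforce simp: orbit_def)

text \<open>The spans of the orbits form a subrepresentation that contains \<open>S\<close>, hence all of \<open>V\<close>.\<close>

lemma span_orbit:
  assumes C: "is_category C" and S: "S \<subseteq> (SIGMA d:UNIV. carrier (V d))"
    and gen: "\<And>W. subrepresentation C F V T W \<Longrightarrow> \<forall>(d, v) \<in> S. v \<in> W d \<Longrightarrow>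
      W = (\<lambda>d. carrier (V d))"
  shows "module.span F (V x) (orbit S x) = carrier (V x)"
proof -
  interpret C: is_category C by (rule C)
  have md: "module F (V x)" for x
    using vectorspace[of x] by (simp add: vectorspace_def)
  have own: "orbit S x \<subseteq> module.span F (V x) (orbit S x)" for x
    by (rule module.in_own_span[OF md orbit_carrier[OF S]])
  have "subrepresentation C F V T (\<lambda>x. module.span F (V x) (orbit S x))"
    unfolding subrepresentation_iff
  proof (intro conjI allI impI)
    fix x show "VectorSpace.subspace F (module.span F (V x) (orbit S x)) (V x)"
      by (rule vectorspace.span_is_subspace[OF vectorspace orbit_carrier[OF S]])
  next
    fix x y f assume f: "f \<in> Hom C x y"
    show "T f ` module.span F (V x) (orbit S x) \<subseteq> module.span F (V y) (orbit S y)"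
    proof (rule hom_image_span_subset[OF md])
      show "T f \<in> module_hom F (V x) (V y)"
        using linear[OF f] by (simp add: linear_map_def mod_hom_def mod_hom_axioms_def)
      have "T f ` orbit S x \<subseteq> orbit S y"
      proof
        fix u assume "u \<in> T f ` orbit S x"
        then obtain d v g where g: "(d, v) \<in> S" "g \<in> Hom C d x" "u = T f (T g v)"
          by (auto simp: orbit_def)
        then have "u = T (Comp C f g) v"
          using map_Comp[OF g(2) f] S by auto
        then show "u \<in> orbit S y"
          using g C.Comp_in_Hom[OF g(2) f] by (auto simp: orbit_def)
      qed
      then show "T f ` orbit S x \<subseteq> module.span F (V y) (orbit S y)"
        using own by blast
    qed (intro module.span_is_submodule[OF md] orbit_carrier S)+
  qed
  moreover have "\<forall>(d, v) \<in> S. v \<in> module.span F (V d) (orbit S d)"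
  proof clarify
    fix d v assume v: "(d, v) \<in> S"
    then have "v = T (Id C d) v" using map_Id[of v d] S by auto
    then have "v \<in> orbit S d" using v C.Id_in_Hom by (auto simp: orbit_def)
    then show "v \<in> module.span F (V d) (orbit S d)" using own by blast
  qed
  ultimately have "(\<lambda>x. module.span F (V x) (orbit S x)) = (\<lambda>d. carrier (V d))"
    by (rule gen)
  then show ?thesis by (rule fun_cong)
qed

lemma fin_dim_of_finite_Hom:
  assumes "is_category C" and S: "S \<subseteq> (SIGMA d:UNIV. carrier (V d))" "finite S"
    and "\<And>W. subrepresentation C F V T W \<Longrightarrow> \<forall>(d, v) \<in> S. v \<in> W d \<Longrightarrow>
      W = (\<lambda>d. carrier (V d))"
    and Hom: "\<And>d. finite (Hom C d x)"
  shows "vectorspace.fin_dim F (V x)"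
proof -
  interpret V: vectorspace F "V x" by (rule vectorspace)
  have "orbit S x = (\<lambda>((d, v), f). T f v) ` (SIGMA p:S. Hom C (fst p) x)"
    by (force simp: orbit_def)
  then have "finite (orbit S x)" using S(2) Hom by simp
  then show ?thesis
    using orbit_carrier[OF S(1)] span_orbit[OF assms(1) S(1) assms(4)]
    unfolding V.fin_dim_def by blast
qed

end

lemma finite_carrier_mat: "finite (carrier_mat m n :: 'a::finite mat set)"
proof -
  have "A \<in> (\<lambda>f. mat m n f) ` (({..<m} \<times> {..<n}) \<rightarrow>\<^sub>E UNIV)"
    if "A \<in> carrier_mat m n" for A :: "'a mat"
    using that by (intro image_eqI[where x = "restrict (($$) A) ({..<m} \<times> {..<n})"]) auto
  moreover have "finite ((\<lambda>f. mat m n f) ` (({..<m} \<times> {..<n}) \<rightarrow>\<^sub>E (UNIV :: 'a set)))"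
    by (intro finite_imageI finite_PiE) auto
  ultimately show ?thesis by (meson finite_subset subsetI)
qed


section \<open>Collapsing along a map\<close>

text \<open>A function \<open>h\<close> from \<open>x\<close> to \<open>y\<close> points, regarded as a relation. Below, \<open>collapse x h\<close> is the
  equivalence relation whose classes are the fibres of \<open>h\<close>, called \<open>r\<^sub>h\<close> above.\<close>

definition graph_mat :: "nat \<Rightarrow> nat \<Rightarrow> (nat \<Rightarrow> nat) \<Rightarrow> bool mat" where
  "graph_mat x y h = mat x y (\<lambda>(a, k). h a = k)"

definition collapse :: "nat \<Rightarrow> (nat \<Rightarrow> nat) \<Rightarrow> bool mat" where
  "collapse x h = mat x x (\<lambda>(a, b). h a = h b)"

definition support :: "bool mat \<Rightarrow> (nat \<times> nat) set" where
  "support A = {(i, j). i < dim_row A \<and> j < dim_col A \<and> A $$ (i, j)}"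

lemma graph_mat_carrier [simp]: "graph_mat x y h \<in> carrier_mat x y"
  by (simp add: graph_mat_def)

lemma collapse_carrier [simp]: "collapse x h \<in> carrier_mat x x"
  by (simp add: collapse_def)

lemma sum_bool_iff: "finite I \<Longrightarrow> sum f I \<longleftrightarrow> (\<exists>i\<in>I. f i)" for f :: "'a \<Rightarrow> bool"
  by (induction I rule: finite_induct) (auto simp: zero_bool_def plus_bool_def)

lemma index_mult_bool_mat:
  fixes A B :: "bool mat"
  assumes "A \<in> carrier_mat x y" "B \<in> carrier_mat y z" "i < x" "j < z"
  shows "(A * B) $$ (i, j) \<longleftrightarrow> (\<exists>k<y. A $$ (i, k) \<and> B $$ (k, j))"
  using assms by (auto simp: scalar_prod_def sum_bool_iff times_bool_def)

text \<open>This is what makes \<open>collapse x h\<close> small: it passes through the object \<open>y\<close>, however large \<open>x\<close> is.\<close>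

lemma collapse_factors:
  assumes "h \<in> {..<x} \<rightarrow> {..<y}"
  shows "collapse x h = graph_mat x y h * transpose_mat (graph_mat x y h)"
proof (rule eq_matI)
  fix i j
  assume ij: "i < dim_row (graph_mat x y h * transpose_mat (graph_mat x y h))"
    "j < dim_col (graph_mat x y h * transpose_mat (graph_mat x y h))"
  then have "i < x" "j < x" by (auto simp: graph_mat_def)
  moreover have "h i < y" using assms \<open>i < x\<close> by auto
  ultimately show "collapse x h $$ (i, j) =
      (graph_mat x y h * transpose_mat (graph_mat x y h)) $$ (i, j)"
    by (subst index_mult_bool_mat[of _ x y _ x]) (auto simp: collapse_def graph_mat_def)
qed (auto simp: collapse_def graph_mat_def)

lemma index_mult_collapse:
  assumes "A \<in> carrier_mat d x" "i < d" "j < x"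
  shows "(A * collapse x h) $$ (i, j) \<longleftrightarrow> (\<exists>a<x. A $$ (i, a) \<and> h a = h j)"
  using assms by (subst index_mult_bool_mat[of _ d x _ x]) (auto simp: collapse_def)

lemma support_collapse:
  assumes "A \<in> carrier_mat d x"
  shows "support A \<subseteq> support (A * collapse x h)"
  using assms index_mult_collapse[OF assms] by (auto simp: support_def collapse_def)

lemma finite_support: "finite (support A)"
  by (rule finite_subset[of _ "{..<dim_row A} \<times> {..<dim_col A}"]) (auto simp: support_def)

lemma support_inject:
  assumes "A \<in> carrier_mat m n" "B \<in> carrier_mat m n" "support A = support B"
  shows "A = B"
proof (rule eq_matI)
  fix i j assume "i < dim_row B" "j < dim_col B"
  then have "(i, j) \<in> support A \<longleftrightarrow> A $$ (i, j)" "(i, j) \<in> support B \<longleftrightarrow> B $$ (i, j)"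
    using assms(1,2) by (auto simp: support_def)
  then show "A $$ (i, j) = B $$ (i, j)" using assms(3) by simp
qed (use assms in auto)

text \<open>Collapsing either fixes a matrix or strictly enlarges it, so the number of entries is a
  measure that increases along all proper collapses.\<close>

lemma collapse_fixes_of_card_le:
  assumes A: "A \<in> carrier_mat d x"
    and le: "card (support (A * collapse x h)) \<le> card (support A)"
  shows "A * collapse x h = A"
proof -
  have "support A = support (A * collapse x h)"
    by (rule card_seteq[OF finite_support support_collapse[OF A] le])
  then show ?thesis
    using A by (intro support_inject[of _ d x]) auto
qed

text \<open>Label each index by a code for its column. There are at most \<open>2 ^ d\<close> columns, so \<open>N\<close> codes
  suffice, and merging indices with equal columns does not change the matrix.\<close>

lemma exists_fixing_collapse:
  assumes A: "A \<in> carrier_mat d x" and N: "2 ^ d \<le> N"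
  shows "\<exists>h \<in> {..<x} \<rightarrow> {..<N}. A * collapse x h = A"
proof -
  define col_set where "col_set a = {i. i < d \<and> A $$ (i, a)}" for a
  have "card (Pow {..<d}) \<le> card {..<N}" using N by (simp add: card_Pow)
  then obtain e where e: "e ` Pow {..<d} \<subseteq> {..<N}" "inj_on e (Pow {..<d})"
    using card_le_inj[of "Pow {..<d}" "{..<N}"] by auto
  have col: "col_set a \<in> Pow {..<d}" for a by (auto simp: col_set_def)
  have "A * collapse x (e \<circ> col_set) = A"
  proof (rule eq_matI)
    fix i j assume "i < dim_row A" "j < dim_col A"
    then have ij: "i < d" "j < x" using A by auto
    have "A $$ (i, a) = A $$ (i, j)" if "e (col_set a) = e (col_set j)" for a
    proof -
      have "col_set a = col_set j" using inj_onD[OF e(2) that] col by blast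
      then have "i \<in> col_set a \<longleftrightarrow> i \<in> col_set j" by simp
      then show ?thesis using ij by (simp add: col_set_def)
    qed
    then show "(A * collapse x (e \<circ> col_set)) $$ (i, j) = A $$ (i, j)"
      unfolding index_mult_collapse[OF A ij] comp_apply using ij by blast
  qed (use A in \<open>auto simp: collapse_def\<close>)
  moreover have "e \<circ> col_set \<in> {..<x} \<rightarrow> {..<N}"
    using image_subset_iff[THEN iffD1, OF e(1)] col by (simp add: Pi_iff)
  ultimately show ?thesis by blast
qed


section \<open>Subrepresentations of representations of Rel\<close>

lemma Hom_Rel [simp]: "Hom Rel x y = carrier_mat x y"
  by (simp add: Rel_def)

lemma Comp_Rel [simp]: "Comp Rel B A = A * B"
  by (simp add: Rel_def)

locale Rel_representation = representation Rel F V T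
  for F :: "('a, 'b) ring_scheme" and V :: "nat \<Rightarrow> ('a, 'v) module" and T
begin

lemma T_mult:
  assumes "A \<in> carrier_mat x y" "B \<in> carrier_mat y z" "v \<in> carrier (V x)"
  shows "T (A * B) v = T B (T A v)"
  using map_Comp[of A x y B z v] assms by simp

text \<open>The collapse carries \<open>w\<close> into \<open>W N \<subseteq> U N\<close> and then from \<open>U N\<close> back into \<open>U x\<close>.\<close>

lemma T_collapse_mem:
  assumes U: "subrepresentation Rel F V T U" and W: "subrepresentation Rel F V T W"
    and N: "W N \<subseteq> U N" and h: "h \<in> {..<x} \<rightarrow> {..<N}" and w: "w \<in> W x"
  shows "T (collapse x h) w \<in> U x"
proof -
  let ?g = "graph_mat x N h"
  have "w \<in> carrier (V x)"
    using W w unfolding subrepresentation_iff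
    by (meson subsetD submodule.subset VectorSpace.subspace.submod)
  then have "T (collapse x h) w = T (transpose_mat ?g) (T ?g w)"
    unfolding collapse_factors[OF h] by (intro T_mult[of _ x N _ x]) auto
  moreover have "T ?g w \<in> U N"
  proof -
    have "T ?g ` W x \<subseteq> W N" using W unfolding subrepresentation_iff by simp
    then show ?thesis using w N by blast
  qed
  moreover have "T (transpose_mat ?g) ` U N \<subseteq> U x"
    using U unfolding subrepresentation_iff by auto
  ultimately show ?thesis by auto
qed

text \<open>The elimination of matrices, by induction on a finite set \<open>B\<close> of terms \<open>A v\<close> that is closed under
  all collapses. Let \<open>A v\<close> be a term with the fewest entries in \<open>A\<close>, and let \<open>h\<close> fix \<open>A\<close>. By
  minimality no other term collapses onto \<open>A v\<close>, so \<open>B\<close> without this term is still closed, and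
  \<open>1 - r\<^sub>h\<close> maps the span of \<open>B\<close> into the span of the rest. As \<open>w\<close> and \<open>(1 - r\<^sub>h) w\<close> agree modulo
  \<open>U x\<close>, the induction hypothesis applies. The terms are indexed by triples \<open>(d, v, A)\<close>, because
  different matrices may give the same vector.\<close>

lemma span_collapse_closed_mem:
  assumes U: "subrepresentation Rel F V T U" and W: "subrepresentation Rel F V T W"
    and UW: "U x \<subseteq> W x" and N: "W N \<subseteq> U N"
    and "finite B"
    and B: "\<And>d v A. (d, v, A) \<in> B \<Longrightarrow> v \<in> carrier (V d) \<and> A \<in> carrier_mat d x \<and> 2 ^ d \<le> N"
    and closed: "\<And>d v A h. (d, v, A) \<in> B \<Longrightarrow> h \<in> {..<x} \<rightarrow> {..<N} \<Longrightarrow>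
      (d, v, A * collapse x h) \<in> B"
    and w: "w \<in> W x" "w \<in> module.span F (V x) ((\<lambda>(d, v, A). T A v) ` B)"
  shows "w \<in> U x"
  using \<open>finite B\<close> B closed w
proof (induction B arbitrary: w rule: finite_psubset_induct)
  case (psubset B)
  note B = psubset.prems(1) and closed = psubset.prems(2) and w = psubset.prems(3,4)
  interpret V: vectorspace F "V x" by (rule vectorspace)
  have subU: "submodule F (U x) (V x)" and subW: "submodule F (W x) (V x)"
    using U W unfolding subrepresentation_iff by (auto intro: VectorSpace.subspace.submod)
  let ?vec = "\<lambda>(d, v, A). T A v"
  show ?case
  proof (cases "B = {}")
    case True
    then show ?thesis using w(2) submodule.zero_closed[OF subU] by (simp add: V.span_empty)
  next
    case False
    then obtain p where p: "p \<in> B"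
      and min: "\<And>q. q \<in> B \<Longrightarrow> card (support (snd (snd p))) \<le> card (support (snd (snd q)))"
      using ex_min_if_finite[of "(\<lambda>q. card (support (snd (snd q)))) ` B"] psubset.hyps
      by (auto simp: not_less)
    obtain d v A where p_eq: "p = (d, v, A)" by (cases p)
    have A: "v \<in> carrier (V d)" "A \<in> carrier_mat d x" "2 ^ d \<le> N"
      using B p by (auto simp: p_eq)
    obtain h where h: "h \<in> {..<x} \<rightarrow> {..<N}" and fixed: "A * collapse x h = A"
      using exists_fixing_collapse[OF A(2,3)] by blast
    let ?B = "B - {p}"
    have closed': "(d', v', A' * collapse x h') \<in> ?B"
      if q: "(d', v', A') \<in> ?B" and h': "h' \<in> {..<x} \<rightarrow> {..<N}" for d' v' A' h'
    proof -
      have "(d', v', A' * collapse x h') \<noteq> p"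
      proof
        assume eq: "(d', v', A' * collapse x h') = p"
        then have "A' * collapse x h' = A'"
          using min[of "(d', v', A')"] q B[of d' v' A']
          by (intro collapse_fixes_of_card_le[of _ d']) auto
        then show False using eq q by simp
      qed
      then show ?thesis using closed[of d' v' A' h'] q h' by blast
    qed
    have carr: "?vec ` B \<subseteq> carrier (V x)"
    proof clarify
      fix d v A assume "(d, v, A) \<in> B"
      then show "T A v \<in> carrier (V x)"
        using B[of d v A] T_closed[of A d x v] by simp
    qed
    let ?\<phi> = "\<lambda>u. u \<ominus>\<^bsub>V x\<^esub> T (collapse x h) u"
    have r: "T (collapse x h) \<in> module_hom F (V x) (V x)"
      using linear[of "collapse x h" x x] by (simp add: linear_map_def mod_hom_def mod_hom_axioms_def)
    have sub': "submodule F (V.span (?vec ` ?B)) (V x)"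
      using carr by (intro V.span_is_submodule) auto
    have "?\<phi> (?vec q) \<in> V.span (?vec ` ?B)" if q: "q \<in> B" for q
    proof -
      obtain d' v' A' where q_eq: "q = (d', v', A')" by (cases q)
      have A': "v' \<in> carrier (V d')" "A' \<in> carrier_mat d' x"
        using B q by (auto simp: q_eq)
      have eq: "T (collapse x h) (?vec q) = T (A' * collapse x h) v'"
        using A' T_mult[of A' d' x "collapse x h" x v'] by (simp add: q_eq)
      have vec: "?vec q \<in> carrier (V x)" using q carr by blast
      show ?thesis
      proof (cases "q = p")
        case True
        then have "?\<phi> (?vec q) = \<zero>\<^bsub>V x\<^esub>"
          using vec fixed unfolding eq by (simp add: p_eq q_eq V.M.minus_eq V.M.r_neg)
        then show ?thesis using submodule.zero_closed[OF sub'] by simp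
      next
        case False
        then have "?vec q \<in> V.span (?vec ` ?B)" "T (A' * collapse x h) v' \<in> V.span (?vec ` ?B)"
          using q closed'[of d' v' A' h] h carr
          by (force intro!: subsetD[OF V.in_own_span] simp: q_eq)+
        then show ?thesis unfolding eq
          by (rule submodule_minus_closed[OF sub'])
      qed
    qed
    then have sp: "?\<phi> w \<in> V.span (?vec ` ?B)"
      using hom_image_span_subset[OF V.module_axioms id_minus_hom[OF V.module_axioms r] sub' carr] w(2) by blast
    have rw: "T (collapse x h) w \<in> U x"
      by (rule T_collapse_mem[OF U W N h w(1)])
    then have rwW: "T (collapse x h) w \<in> W x"
      using UW by blast
    then have "?\<phi> w \<in> W x"
      using w(1) by (intro submodule_minus_closed[OF subW])
    then have "?\<phi> w \<in> U x"
      using sp psubset.IH[of ?B "?\<phi> w"] p B closed' by blast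
    then have "?\<phi> w \<oplus>\<^bsub>V x\<^esub> T (collapse x h) w \<in> U x"
      using rw submodule.m_closed[OF subU] by blast
    moreover have "?\<phi> w \<oplus>\<^bsub>V x\<^esub> T (collapse x h) w = w"
      using w(1) rwW submodule.subset[OF subW]
      by (auto simp: a_minus_def V.M.a_assoc V.M.l_neg subset_iff)
    ultimately show ?thesis by simp
  qed
qed

text \<open>The set of all matrices from the degrees of the generators to \<open>x\<close> is closed under collapses, and
  by \<open>span_orbit\<close> its terms span \<open>V x\<close>.\<close>

lemma subrepresentations_eq_of_eq_at:
  assumes S: "S \<subseteq> (SIGMA d:UNIV. carrier (V d))" "finite S"
    and gen: "\<And>W. subrepresentation Rel F V T W \<Longrightarrow> \<forall>(d, v) \<in> S. v \<in> W d \<Longrightarrow>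
      W = (\<lambda>d. carrier (V d))"
    and N: "\<And>d v. (d, v) \<in> S \<Longrightarrow> 2 ^ d \<le> N"
    and U: "subrepresentation Rel F V T U" and W: "subrepresentation Rel F V T W"
    and "U \<le> W" and "U N = W N"
  shows "U = W"
proof -
  have "W x \<subseteq> U x" for x
  proof
    fix w assume w: "w \<in> W x"
    define B where "B = (\<lambda>((d, v), A). (d, v, A)) ` (SIGMA p:S. (carrier_mat (fst p) x :: bool mat set))"
    have mem: "(d, v, A) \<in> B \<longleftrightarrow> (d, v) \<in> S \<and> A \<in> carrier_mat d x" for d v A
      by (force simp: B_def)
    have "finite B"
      using S(2) unfolding B_def by (intro finite_imageI finite_SigmaI finite_carrier_mat) simp_all
    have orbit: "(\<lambda>(d, v, A). T A v) ` B = orbit S x"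
    proof -
      have "(\<lambda>(d, v, A). T A v) ` B = {T A v | d v A. (d, v, A) \<in> B}" by force
      then show ?thesis by (simp add: orbit_def mem)
    qed
    have "w \<in> carrier (V x)"
      using W w unfolding subrepresentation_iff
      by (meson subsetD submodule.subset VectorSpace.subspace.submod)
    then have "w \<in> module.span F (V x) ((\<lambda>(d, v, A). T A v) ` B)"
      unfolding orbit using span_orbit[OF is_category_Rel S(1) gen] by simp
    with w show "w \<in> U x"
      using \<open>U \<le> W\<close> \<open>U N = W N\<close> \<open>finite B\<close> N S(1)
      by (intro span_collapse_closed_mem[OF U W, where B = B and N = N])
        (auto simp: mem le_fun_def intro: mult_carrier_mat[OF _ collapse_carrier])
  qed
  then have "W \<le> U" by (rule le_funI)
  with \<open>U \<le> W\<close> show ?thesis by (rule antisym)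
qed

lemma finite_length_of_finitely_generated:
  assumes "finitely_generated Rel F V T"
  shows "finite_length Rel F V T"
proof -
  obtain S where S: "S \<subseteq> (SIGMA d:UNIV. carrier (V d))" "finite S"
    and gen: "\<And>W. subrepresentation Rel F V T W \<Longrightarrow> \<forall>(d, v) \<in> S. v \<in> W d \<Longrightarrow>
      W = (\<lambda>d. carrier (V d))"
    using assms unfolding finitely_generated_def by blast
  \<comment> \<open>The sum serves as an upper bound of the \<open>2 ^ d\<close> that is meaningful also for empty \<open>S\<close>.\<close>
  define N where "N = (\<Sum>p\<in>S. 2 ^ fst p :: nat)"
  have N: "2 ^ d \<le> N" if "(d, v) \<in> S" for d v
    using member_le_sum[OF that, of "\<lambda>p. 2 ^ fst p :: nat"] S(2) by (simp add: N_def)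
  interpret V: vectorspace F "V N" by (rule vectorspace)
  show ?thesis
    unfolding finite_length_def
  proof (intro allI impI)
    fix K assume K: "K \<subseteq> {W. subrepresentation Rel F V T W}"
      and chain: "Complete_Partial_Order.chain (\<le>) K"
    have fin: "finite ((\<lambda>W. W N) ` K)"
    proof (rule V.finite_chain_of_subspaces)
      show V.fin_dim
        by (rule fin_dim_of_finite_Hom[OF is_category_Rel S gen]) (simp_all add: finite_carrier_mat)
      show "VectorSpace.subspace F W (V N)" if "W \<in> (\<lambda>W. W N) ` K" for W
        using that K by (auto simp: subrepresentation_iff)
      show "Complete_Partial_Order.chain (\<subseteq>) ((\<lambda>W. W N) ` K)"
        using chain by (fastforce simp: Complete_Partial_Order.chain_def le_fun_def)
    qed
    have eq_at: "U = W"
      if "subrepresentation Rel F V T U" "subrepresentation Rel F V T W" "U \<le> W" "U N = W N" for U W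
      by (rule subrepresentations_eq_of_eq_at[OF S]) (fact gen N that)+
    have inj: "inj_on (\<lambda>W. W N) K"
    proof (rule inj_onI)
      fix U W assume UW: "U \<in> K" "W \<in> K" "U N = W N"
      then have "U \<le> W \<or> W \<le> U" using chain by (auto simp: Complete_Partial_Order.chain_def)
      moreover have "subrepresentation Rel F V T U" "subrepresentation Rel F V T W"
        using UW K by auto
      ultimately show "U = W"
        using eq_at[of U W] eq_at[of W U] UW(3) by auto
    qed
    show "finite K" by (rule finite_imageD[OF fin inj])
  qed
qed

end

theorem corollary3p1:
  fixes F :: "('a, 'b) ring_scheme"
  assumes "field F" and "infinite (carrier F)"
  shows "dimension_zero TYPE('v) Rel F"
  unfolding dimension_zero_def
proof (intro allI impI)
  fix V :: "nat \<Rightarrow> ('a, 'v) module" and T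
  assume "representation Rel F V T" and "finitely_generated Rel F V T"
  then show "finite_length Rel F V T"
    by (intro Rel_representation.finite_length_of_finitely_generated Rel_representation.intro)
qed

end
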